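(* Let $(M,J,\nabla,\omega)$ be a special symplectic manifold and assume that the $(1,1)$-component $\omega^{11}$ of $\omega$ is nondegenerate. Then $(M,J,\omega^{11})$ is a Kähler manifold with Kähler metric $g=\omega^{11}(J\cdot,\cdot)$. Moreover, $(M,J,\nabla,\omega^{11})$ is special Kähler if and only if $\nabla\omega^{11}=0$.
   Context: Kähler metrics are allowed to be indefinite. A special complex manifold $(M,J,\nabla)$ is a complex manifold $(M,J)$ together with a flat torsionfree connection $\nabla$ on its real tangent bundle such that $d^\nabla J=0$, i.e. $(\nabla_XJ)Y=(\nabla_YJ)X$ for all $X,Y$. A special symplectic manifold $(M,J,\nabla,\omega)$ is a special complex manifold with a $\nabla$-parallel symplectic form $\omega$; it is special Kähler if moreover $\omega$ is $J$-invariant, i.e. of type $(1,1)$. $\omega=\omega^{11}+\omega^{20}+\omega^{02}$ denotes the Hodge decomposition with respect to $J$. *)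

theory Defs
  imports "HOL-Analysis.Analysis" "HOL-Library.Function_Algebras"
begin

text \<open>
  The manifold is the whole type \<open>'a\<close>, a Hausdorff second countable space, with a holomorphic
  atlas \<open>A\<close> of charts with values in \<open>complex ^ 'n\<close>. Sums and products of functions, tangent
  vectors and vector fields are the pointwise ones of \<open>HOL-Library.Function_Algebras\<close>.
\<close>

type_synonym ('a, 'n) chart = "'a set \<times> ('a \<Rightarrow> complex ^ 'n)"

type_synonym 'a tvec = "('a \<Rightarrow> real) \<Rightarrow> real"
type_synonym 'a vfield = "'a \<Rightarrow> 'a tvec"
type_synonym 'a bilin = "'a tvec \<Rightarrow> 'a tvec \<Rightarrow> real"


section \<open>Complex manifolds\<close>

text \<open>Both definitions are meant for open \<open>S\<close>. The second is holomorphy in several variables as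
  Frechet differentiability with complex linear derivative.\<close>

primrec Ck_on :: "nat \<Rightarrow> 'e::real_normed_vector set \<Rightarrow> ('e \<Rightarrow> real) \<Rightarrow> bool" where
  "Ck_on 0 S f \<longleftrightarrow> continuous_on S f"
| "Ck_on (Suc k) S f \<longleftrightarrow>
     (\<forall>x\<in>S. f differentiable (at x)) \<and>
     (\<forall>v. Ck_on k S (\<lambda>x. frechet_derivative f (at x) v))"

definition smooth_on :: "'e::real_normed_vector set \<Rightarrow> ('e \<Rightarrow> real) \<Rightarrow> bool" where
  "smooth_on S f \<longleftrightarrow> (\<forall>k. Ck_on k S f)"

definition holomorphic_map_on ::
    "(complex ^ 'n::finite) set \<Rightarrow> (complex ^ 'n \<Rightarrow> complex ^ 'm::finite) \<Rightarrow> bool" where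
  "holomorphic_map_on S F \<longleftrightarrow>
     (\<forall>x\<in>S. \<exists>D. (F has_derivative D) (at x) \<and> (\<forall>v. D (\<i> *s v) = \<i> *s D v))"

definition holomorphic_atlas ::
    "('a::{t2_space, second_countable_topology}, 'n::finite) chart set \<Rightarrow> bool" where
  "holomorphic_atlas A \<longleftrightarrow>
     (\<Union>(U, \<phi>)\<in>A. U) = UNIV \<and>
     (\<forall>(U, \<phi>)\<in>A. open U \<and> open (\<phi> ` U) \<and> homeomorphism U (\<phi> ` U) \<phi> (inv_into U \<phi>)) \<and>
     (\<forall>(U, \<phi>)\<in>A. \<forall>(V, \<psi>)\<in>A. holomorphic_map_on (\<phi> ` (U \<inter> V)) (\<psi> \<circ> inv_into U \<phi>))"

definition smooth_fun :: "('a, 'n::finite) chart set \<Rightarrow> ('a \<Rightarrow> real) \<Rightarrow> bool" where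
  "smooth_fun A f \<longleftrightarrow> (\<forall>(U, \<phi>)\<in>A. smooth_on (\<phi> ` U) (f \<circ> inv_into U \<phi>))"

text \<open>Tangent vectors at \<open>p\<close> are the derivations at \<open>p\<close> of the algebra of smooth functions,
  extended by \<open>0\<close> to all functions, so that equality of tangent vectors is equality in HOL.\<close>

definition tangent_space :: "('a, 'n::finite) chart set \<Rightarrow> 'a \<Rightarrow> 'a tvec set" where
  "tangent_space A p = {v.
     (\<forall>f. \<not> smooth_fun A f \<longrightarrow> v f = 0) \<and>
     (\<forall>f g. smooth_fun A f \<longrightarrow> smooth_fun A g \<longrightarrow> v (f + g) = v f + v g) \<and>
     (\<forall>c f. smooth_fun A f \<longrightarrow> v (\<lambda>x. c * f x) = c * v f) \<and>
     (\<forall>f g. smooth_fun A f \<longrightarrow> smooth_fun A g \<longrightarrow> v (f * g) = v f * g p + f p * v g)}"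

definition vscale :: "real \<Rightarrow> 'a tvec \<Rightarrow> 'a tvec" where
  "vscale c v = (\<lambda>f. c * v f)"

text \<open>The tangent vector at \<open>p\<close> with coordinate vector \<open>\<xi>\<close> in the chart \<open>(U, \<phi>)\<close>.\<close>

definition coord_vec ::
    "('a, 'n::finite) chart set \<Rightarrow> ('a, 'n) chart \<Rightarrow> 'a \<Rightarrow> complex ^ 'n \<Rightarrow> 'a tvec" where
  "coord_vec A c p \<xi> = (\<lambda>f. if smooth_fun A f
     then frechet_derivative (f \<circ> inv_into (fst c) (snd c)) (at (snd c p)) \<xi> else 0)"

definition vector_field :: "('a, 'n::finite) chart set \<Rightarrow> 'a vfield \<Rightarrow> bool" where
  "vector_field A X \<longleftrightarrow>
     (\<forall>p. X p \<in> tangent_space A p) \<and> (\<forall>f. smooth_fun A f \<longrightarrow> smooth_fun A (\<lambda>p. X p f))"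

definition fscale :: "('a \<Rightarrow> real) \<Rightarrow> 'a vfield \<Rightarrow> 'a vfield" where
  "fscale h X = (\<lambda>p. vscale (h p) (X p))"

definition lie_bracket :: "'a vfield \<Rightarrow> 'a vfield \<Rightarrow> 'a vfield" where
  "lie_bracket X Y = (\<lambda>p f. X p (\<lambda>q. Y q f) - Y p (\<lambda>q. X q f))"

definition appl :: "('a \<Rightarrow> 'a tvec \<Rightarrow> 'a tvec) \<Rightarrow> 'a vfield \<Rightarrow> 'a vfield" where
  "appl J X = (\<lambda>p. J p (X p))"

definition almost_complex_structure ::
    "('a, 'n::finite) chart set \<Rightarrow> ('a \<Rightarrow> 'a tvec \<Rightarrow> 'a tvec) \<Rightarrow> bool" where
  "almost_complex_structure A J \<longleftrightarrow>
     (\<forall>p. \<forall>v\<in>tangent_space A p. J p v \<in> tangent_space A p) \<and>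
     (\<forall>p. \<forall>v\<in>tangent_space A p. \<forall>w\<in>tangent_space A p. J p (v + w) = J p v + J p w) \<and>
     (\<forall>p. \<forall>v\<in>tangent_space A p. \<forall>c. J p (vscale c v) = vscale c (J p v)) \<and>
     (\<forall>p. \<forall>v\<in>tangent_space A p. J p (J p v) = - v) \<and>
     (\<forall>X. vector_field A X \<longrightarrow> vector_field A (appl J X))"

text \<open>The last clause says that \<open>J\<close> is the complex structure induced by the holomorphic atlas; it
  determines \<open>J\<close> on tangent vectors.\<close>

definition complex_manifold ::
    "('a::{t2_space, second_countable_topology}, 'n::finite) chart set
      \<Rightarrow> ('a \<Rightarrow> 'a tvec \<Rightarrow> 'a tvec) \<Rightarrow> bool" where
  "complex_manifold A J \<longleftrightarrow>
     holomorphic_atlas A \<and> almost_complex_structure A J \<and>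
     (\<forall>(U, \<phi>)\<in>A. \<forall>p\<in>U. \<forall>\<xi>.
        J p (coord_vec A (U, \<phi>) p \<xi>) = coord_vec A (U, \<phi>) p (\<i> *s \<xi>))"


section \<open>Connections\<close>

definition connection ::
    "('a, 'n::finite) chart set \<Rightarrow> ('a vfield \<Rightarrow> 'a vfield \<Rightarrow> 'a vfield) \<Rightarrow> bool" where
  "connection A nabla \<longleftrightarrow>
     (\<forall>X Y. vector_field A X \<longrightarrow> vector_field A Y \<longrightarrow> vector_field A (nabla X Y)) \<and>
     (\<forall>X X' Y. vector_field A X \<longrightarrow> vector_field A X' \<longrightarrow> vector_field A Y \<longrightarrow>
        nabla (X + X') Y = nabla X Y + nabla X' Y) \<and>
     (\<forall>h X Y. smooth_fun A h \<longrightarrow> vector_field A X \<longrightarrow> vector_field A Y \<longrightarrow>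
        nabla (fscale h X) Y = fscale h (nabla X Y)) \<and>
     (\<forall>X Y Y'. vector_field A X \<longrightarrow> vector_field A Y \<longrightarrow> vector_field A Y' \<longrightarrow>
        nabla X (Y + Y') = nabla X Y + nabla X Y') \<and>
     (\<forall>h X Y. smooth_fun A h \<longrightarrow> vector_field A X \<longrightarrow> vector_field A Y \<longrightarrow>
        nabla X (fscale h Y) = fscale (\<lambda>p. X p h) Y + fscale h (nabla X Y))"

definition torsionfree ::
    "('a, 'n::finite) chart set \<Rightarrow> ('a vfield \<Rightarrow> 'a vfield \<Rightarrow> 'a vfield) \<Rightarrow> bool" where
  "torsionfree A nabla \<longleftrightarrow>
     (\<forall>X Y. vector_field A X \<longrightarrow> vector_field A Y \<longrightarrow>
        nabla X Y - nabla Y X - lie_bracket X Y = 0)"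

definition flat ::
    "('a, 'n::finite) chart set \<Rightarrow> ('a vfield \<Rightarrow> 'a vfield \<Rightarrow> 'a vfield) \<Rightarrow> bool" where
  "flat A nabla \<longleftrightarrow>
     (\<forall>X Y Z. vector_field A X \<longrightarrow> vector_field A Y \<longrightarrow> vector_field A Z \<longrightarrow>
        nabla X (nabla Y Z) - nabla Y (nabla X Z) - nabla (lie_bracket X Y) Z = 0)"

text \<open>\<open>cov_deriv_endo nabla J X Y\<close> is the vector field obtained by applying the covariant
  derivative of \<open>J\<close> in direction \<open>X\<close> to \<open>Y\<close>; likewise for bilinear forms below.\<close>

definition cov_deriv_endo ::
    "('a vfield \<Rightarrow> 'a vfield \<Rightarrow> 'a vfield) \<Rightarrow> ('a \<Rightarrow> 'a tvec \<Rightarrow> 'a tvec)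
      \<Rightarrow> 'a vfield \<Rightarrow> 'a vfield \<Rightarrow> 'a vfield" where
  "cov_deriv_endo nabla J X Y = nabla X (appl J Y) - appl J (nabla X Y)"

definition cov_deriv_form ::
    "('a vfield \<Rightarrow> 'a vfield \<Rightarrow> 'a vfield) \<Rightarrow> ('a \<Rightarrow> 'a bilin)
      \<Rightarrow> 'a vfield \<Rightarrow> 'a vfield \<Rightarrow> 'a vfield \<Rightarrow> 'a \<Rightarrow> real" where
  "cov_deriv_form nabla \<omega> X Y Z = (\<lambda>p.
     X p (\<lambda>q. \<omega> q (Y q) (Z q)) - \<omega> p (nabla X Y p) (Z p) - \<omega> p (Y p) (nabla X Z p))"

definition parallel_form ::
    "('a, 'n::finite) chart set \<Rightarrow> ('a vfield \<Rightarrow> 'a vfield \<Rightarrow> 'a vfield)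
      \<Rightarrow> ('a \<Rightarrow> 'a bilin) \<Rightarrow> bool" where
  "parallel_form A nabla \<omega> \<longleftrightarrow>
     (\<forall>X Y Z. vector_field A X \<longrightarrow> vector_field A Y \<longrightarrow> vector_field A Z \<longrightarrow>
        cov_deriv_form nabla \<omega> X Y Z = 0)"


section \<open>Symplectic forms and metrics\<close>

definition bilinear_field :: "('a, 'n::finite) chart set \<Rightarrow> ('a \<Rightarrow> 'a bilin) \<Rightarrow> bool" where
  "bilinear_field A B \<longleftrightarrow>
     (\<forall>p. \<forall>u\<in>tangent_space A p. \<forall>v\<in>tangent_space A p. \<forall>w\<in>tangent_space A p.
        B p (u + v) w = B p u w + B p v w \<and> B p w (u + v) = B p w u + B p w v) \<and>
     (\<forall>p. \<forall>u\<in>tangent_space A p. \<forall>v\<in>tangent_space A p. \<forall>c.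
        B p (vscale c u) v = c * B p u v \<and> B p u (vscale c v) = c * B p u v) \<and>
     (\<forall>X Y. vector_field A X \<longrightarrow> vector_field A Y \<longrightarrow> smooth_fun A (\<lambda>p. B p (X p) (Y p)))"

definition two_form :: "('a, 'n::finite) chart set \<Rightarrow> ('a \<Rightarrow> 'a bilin) \<Rightarrow> bool" where
  "two_form A \<omega> \<longleftrightarrow> bilinear_field A \<omega> \<and> (\<forall>p. \<forall>v\<in>tangent_space A p. \<omega> p v v = 0)"

definition nondegenerate :: "('a, 'n::finite) chart set \<Rightarrow> ('a \<Rightarrow> 'a bilin) \<Rightarrow> bool" where
  "nondegenerate A B \<longleftrightarrow>
     (\<forall>p. \<forall>v\<in>tangent_space A p. (\<forall>w\<in>tangent_space A p. B p v w = 0) \<longrightarrow> v = 0)"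

definition ext_deriv ::
    "('a \<Rightarrow> 'a bilin) \<Rightarrow> 'a vfield \<Rightarrow> 'a vfield \<Rightarrow> 'a vfield \<Rightarrow> 'a \<Rightarrow> real" where
  "ext_deriv \<omega> X Y Z = (\<lambda>p.
     X p (\<lambda>q. \<omega> q (Y q) (Z q)) + Y p (\<lambda>q. \<omega> q (Z q) (X q)) + Z p (\<lambda>q. \<omega> q (X q) (Y q))
     - \<omega> p (lie_bracket X Y p) (Z p) - \<omega> p (lie_bracket Y Z p) (X p)
     - \<omega> p (lie_bracket Z X p) (Y p))"

definition closed_form :: "('a, 'n::finite) chart set \<Rightarrow> ('a \<Rightarrow> 'a bilin) \<Rightarrow> bool" where
  "closed_form A \<omega> \<longleftrightarrow>
     (\<forall>X Y Z. vector_field A X \<longrightarrow> vector_field A Y \<longrightarrow> vector_field A Z \<longrightarrow>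
        ext_deriv \<omega> X Y Z = 0)"

definition symplectic_form :: "('a, 'n::finite) chart set \<Rightarrow> ('a \<Rightarrow> 'a bilin) \<Rightarrow> bool" where
  "symplectic_form A \<omega> \<longleftrightarrow> two_form A \<omega> \<and> nondegenerate A \<omega> \<and> closed_form A \<omega>"

definition J_invariant ::
    "('a, 'n::finite) chart set \<Rightarrow> ('a \<Rightarrow> 'a tvec \<Rightarrow> 'a tvec) \<Rightarrow> ('a \<Rightarrow> 'a bilin) \<Rightarrow> bool" where
  "J_invariant A J B \<longleftrightarrow>
     (\<forall>p. \<forall>v\<in>tangent_space A p. \<forall>w\<in>tangent_space A p. B p (J p v) (J p w) = B p v w)"

definition pseudo_riemannian_metric ::
    "('a, 'n::finite) chart set \<Rightarrow> ('a \<Rightarrow> 'a bilin) \<Rightarrow> bool" where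
  "pseudo_riemannian_metric A g \<longleftrightarrow>
     bilinear_field A g \<and>
     (\<forall>p. \<forall>v\<in>tangent_space A p. \<forall>w\<in>tangent_space A p. g p v w = g p w v) \<and>
     nondegenerate A g"

definition metric_of ::
    "('a \<Rightarrow> 'a tvec \<Rightarrow> 'a tvec) \<Rightarrow> ('a \<Rightarrow> 'a bilin) \<Rightarrow> 'a \<Rightarrow> 'a bilin" where
  "metric_of J \<omega> = (\<lambda>p v w. \<omega> p (J p v) w)"

text \<open>\<open>kaehler_manifold A J \<omega> g\<close>: \<open>g\<close> is a Kaehler metric, possibly indefinite, with Kaehler form
  \<open>\<omega>\<close>, where form and metric are related by \<open>g = \<omega>(J\<cdot>,\<cdot>)\<close>.\<close>

definition kaehler_manifold ::
    "('a::{t2_space, second_countable_topology}, 'n::finite) chart set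
      \<Rightarrow> ('a \<Rightarrow> 'a tvec \<Rightarrow> 'a tvec) \<Rightarrow> ('a \<Rightarrow> 'a bilin) \<Rightarrow> ('a \<Rightarrow> 'a bilin) \<Rightarrow> bool" where
  "kaehler_manifold A J \<omega> g \<longleftrightarrow>
     complex_manifold A J \<and> pseudo_riemannian_metric A g \<and> J_invariant A J g \<and>
     symplectic_form A \<omega> \<and> J_invariant A J \<omega> \<and>
     (\<forall>p. \<forall>v\<in>tangent_space A p. \<forall>w\<in>tangent_space A p. g p v w = metric_of J \<omega> p v w)"


section \<open>Special complex, symplectic and Kaehler manifolds\<close>

definition special_complex ::
    "('a::{t2_space, second_countable_topology}, 'n::finite) chart set
      \<Rightarrow> ('a \<Rightarrow> 'a tvec \<Rightarrow> 'a tvec) \<Rightarrow> ('a vfield \<Rightarrow> 'a vfield \<Rightarrow> 'a vfield) \<Rightarrow> bool" where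
  "special_complex A J nabla \<longleftrightarrow>
     complex_manifold A J \<and> connection A nabla \<and> flat A nabla \<and> torsionfree A nabla \<and>
     (\<forall>X Y. vector_field A X \<longrightarrow> vector_field A Y \<longrightarrow>
        cov_deriv_endo nabla J X Y = cov_deriv_endo nabla J Y X)"

definition special_symplectic ::
    "('a::{t2_space, second_countable_topology}, 'n::finite) chart set
      \<Rightarrow> ('a \<Rightarrow> 'a tvec \<Rightarrow> 'a tvec) \<Rightarrow> ('a vfield \<Rightarrow> 'a vfield \<Rightarrow> 'a vfield)
      \<Rightarrow> ('a \<Rightarrow> 'a bilin) \<Rightarrow> bool" where
  "special_symplectic A J nabla \<omega> \<longleftrightarrow>
     special_complex A J nabla \<and> symplectic_form A \<omega> \<and> parallel_form A nabla \<omega>"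

definition special_kaehler ::
    "('a::{t2_space, second_countable_topology}, 'n::finite) chart set
      \<Rightarrow> ('a \<Rightarrow> 'a tvec \<Rightarrow> 'a tvec) \<Rightarrow> ('a vfield \<Rightarrow> 'a vfield \<Rightarrow> 'a vfield)
      \<Rightarrow> ('a \<Rightarrow> 'a bilin) \<Rightarrow> bool" where
  "special_kaehler A J nabla \<omega> \<longleftrightarrow> special_symplectic A J nabla \<omega> \<and> J_invariant A J \<omega>"


section \<open>Hodge decomposition\<close>

text \<open>A complex tangent vector, an element of the complexified tangent space, is represented by
  the complex valued functional \<open>f \<mapsto> u f + \<i> w f\<close> with \<open>u\<close>, \<open>w\<close> real tangent vectors.
  Real endomorphisms and bilinear forms are extended complex linearly.\<close>

type_synonym 'a ctvec = "('a \<Rightarrow> real) \<Rightarrow> complex"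

definition re_vec :: "'a ctvec \<Rightarrow> 'a tvec" where "re_vec Z = (\<lambda>f. Re (Z f))"
definition im_vec :: "'a ctvec \<Rightarrow> 'a tvec" where "im_vec Z = (\<lambda>f. Im (Z f))"
definition cvec :: "'a tvec \<Rightarrow> 'a ctvec" where "cvec v = (\<lambda>f. complex_of_real (v f))"

definition tangent_space_C :: "('a, 'n::finite) chart set \<Rightarrow> 'a \<Rightarrow> 'a ctvec set" where
  "tangent_space_C A p = {Z. re_vec Z \<in> tangent_space A p \<and> im_vec Z \<in> tangent_space A p}"

definition endo_C :: "('a tvec \<Rightarrow> 'a tvec) \<Rightarrow> 'a ctvec \<Rightarrow> 'a ctvec" where
  "endo_C L Z = (\<lambda>f. Complex (L (re_vec Z) f) (L (im_vec Z) f))"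

definition bilin_C :: "'a bilin \<Rightarrow> 'a ctvec \<Rightarrow> 'a ctvec \<Rightarrow> complex" where
  "bilin_C B Z W = Complex
     (B (re_vec Z) (re_vec W) - B (im_vec Z) (im_vec W))
     (B (re_vec Z) (im_vec W) + B (im_vec Z) (re_vec W))"

text \<open>The projections onto the eigenspaces of \<open>L\<close> for the eigenvalues \<open>\<i>\<close> and \<open>-\<i>\<close>, that is onto
  the vectors of type (1,0) and (0,1), and the induced components of a 2-form.\<close>

definition proj10 :: "('a tvec \<Rightarrow> 'a tvec) \<Rightarrow> 'a ctvec \<Rightarrow> 'a ctvec" where
  "proj10 L Z = (\<lambda>f. (Z f - \<i> * endo_C L Z f) / 2)"

definition proj01 :: "('a tvec \<Rightarrow> 'a tvec) \<Rightarrow> 'a ctvec \<Rightarrow> 'a ctvec" where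
  "proj01 L Z = (\<lambda>f. (Z f + \<i> * endo_C L Z f) / 2)"

definition part20 :: "('a tvec \<Rightarrow> 'a tvec) \<Rightarrow> 'a bilin \<Rightarrow> 'a ctvec \<Rightarrow> 'a ctvec \<Rightarrow> complex" where
  "part20 L B Z W = bilin_C B (proj10 L Z) (proj10 L W)"

definition part11 :: "('a tvec \<Rightarrow> 'a tvec) \<Rightarrow> 'a bilin \<Rightarrow> 'a ctvec \<Rightarrow> 'a ctvec \<Rightarrow> complex" where
  "part11 L B Z W =
     bilin_C B (proj10 L Z) (proj01 L W) + bilin_C B (proj01 L Z) (proj10 L W)"

definition part02 :: "('a tvec \<Rightarrow> 'a tvec) \<Rightarrow> 'a bilin \<Rightarrow> 'a ctvec \<Rightarrow> 'a ctvec \<Rightarrow> complex" where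
  "part02 L B Z W = bilin_C B (proj01 L Z) (proj01 L W)"

text \<open>The (1,1)-component of a real 2-form is real on real vectors (lemma \<open>part11_real\<close>), so taking the
  real part only changes its type.\<close>

definition hodge11 ::
    "('a \<Rightarrow> 'a tvec \<Rightarrow> 'a tvec) \<Rightarrow> ('a \<Rightarrow> 'a bilin) \<Rightarrow> 'a \<Rightarrow> 'a bilin" where
  "hodge11 J \<omega> = (\<lambda>p v w. Re (part11 (J p) (\<omega> p) (cvec v) (cvec w)))"

lemma tangent_space_add:
  "v \<in> tangent_space A p \<Longrightarrow> w \<in> tangent_space A p \<Longrightarrow> v + w \<in> tangent_space A p"
  by (auto simp: tangent_space_def algebra_simps)

lemma tangent_space_vscale: "v \<in> tangent_space A p \<Longrightarrow> vscale c v \<in> tangent_space A p"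
  by (auto simp: tangent_space_def vscale_def algebra_simps)

lemmas tangent_space_closed = tangent_space_add tangent_space_vscale

text \<open>The three parts sum to the complex linear extension of the form, and
  they are of type (2,0), (1,1) and (0,2). \<open>Z\<close>, \<open>Z'\<close> are of type (1,0) and \<open>W\<close>, \<open>W'\<close> of
  type (0,1).\<close>

lemma hodge_sum:
  assumes J: "almost_complex_structure A J" and \<omega>: "two_form A \<omega>"
    and Z: "Z \<in> tangent_space_C A p" and W: "W \<in> tangent_space_C A p"
  shows "bilin_C (\<omega> p) Z W =
    part20 (J p) (\<omega> p) Z W + part11 (J p) (\<omega> p) Z W + part02 (J p) (\<omega> p) Z W"
proof -
  define half where "half v = vscale (1/2) v" for v :: "'a tvec"
  define T where "T = tangent_space A p"
  have r: "re_vec (proj10 (J p) X) = half (re_vec X) + half (J p (im_vec X))"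
    "im_vec (proj10 (J p) X) = half (im_vec X) + vscale (-1) (half (J p (re_vec X)))"
    "re_vec (proj01 (J p) X) = half (re_vec X) + vscale (-1) (half (J p (im_vec X)))"
    "im_vec (proj01 (J p) X) = half (im_vec X) + half (J p (re_vec X))" for X
    by (auto simp: re_vec_def im_vec_def proj10_def proj01_def endo_C_def half_def
        vscale_def fun_eq_iff field_simps)
  have T: "v \<in> T \<Longrightarrow> w \<in> T \<Longrightarrow> v + w \<in> T" "v \<in> T \<Longrightarrow> vscale c v \<in> T" "v \<in> T \<Longrightarrow> half v \<in> T"
    for v w c using tangent_space_closed by (auto simp: T_def half_def)
  have JT: "v \<in> T \<Longrightarrow> J p v \<in> T" for v using J by (auto simp: almost_complex_structure_def T_def)
  have B: "u \<in> T \<Longrightarrow> v \<in> T \<Longrightarrow> w \<in> T \<Longrightarrow> \<omega> p (u + v) w = \<omega> p u w + \<omega> p v w"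
    "u \<in> T \<Longrightarrow> v \<in> T \<Longrightarrow> w \<in> T \<Longrightarrow> \<omega> p w (u + v) = \<omega> p w u + \<omega> p w v"
    "u \<in> T \<Longrightarrow> v \<in> T \<Longrightarrow> \<omega> p (vscale c u) v = c * \<omega> p u v"
    "u \<in> T \<Longrightarrow> v \<in> T \<Longrightarrow> \<omega> p u (vscale c v) = c * \<omega> p u v"
    "u \<in> T \<Longrightarrow> v \<in> T \<Longrightarrow> \<omega> p (half u) v = (1/2) * \<omega> p u v"
    "u \<in> T \<Longrightarrow> v \<in> T \<Longrightarrow> \<omega> p u (half v) = (1/2) * \<omega> p u v" for u v w c
    using \<omega> by (auto simp: two_form_def bilinear_field_def T_def half_def)
  have m: "re_vec Z \<in> T" "im_vec Z \<in> T" "re_vec W \<in> T" "im_vec W \<in> T"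
    using Z W by (auto simp: tangent_space_C_def T_def)
  show ?thesis
    unfolding part20_def part11_def part02_def bilin_C_def r
    by (simp add: B T JT m complex_eq_iff) (simp add: field_simps)
qed

lemma bilin_C_zero:
  assumes "two_form A \<omega>" "U \<in> tangent_space_C A p"
  shows "bilin_C (\<omega> p) (\<lambda>f. 0) U = 0" "bilin_C (\<omega> p) U (\<lambda>f. 0) = 0"
proof -
  have z: "re_vec (\<lambda>f. 0) = vscale 0 (re_vec U)" "im_vec (\<lambda>f. 0) = vscale 0 (re_vec U)"
    by (auto simp: re_vec_def im_vec_def vscale_def)
  show "bilin_C (\<omega> p) (\<lambda>f. 0) U = 0" "bilin_C (\<omega> p) U (\<lambda>f. 0) = 0"
    using assms unfolding bilin_C_def z
    by (auto simp: two_form_def bilinear_field_def tangent_space_C_def complex_eq_iff)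
qed

lemma proj_closed:
  assumes "almost_complex_structure A J" "V \<in> tangent_space_C A p"
  shows "proj10 (J p) V \<in> tangent_space_C A p" "proj01 (J p) V \<in> tangent_space_C A p"
proof -
  have r: "re_vec (proj10 (J p) V) = vscale (1/2) (re_vec V + J p (im_vec V))"
    "im_vec (proj10 (J p) V) = vscale (1/2) (im_vec V + vscale (-1) (J p (re_vec V)))"
    "re_vec (proj01 (J p) V) = vscale (1/2) (re_vec V + vscale (-1) (J p (im_vec V)))"
    "im_vec (proj01 (J p) V) = vscale (1/2) (im_vec V + J p (re_vec V))"
    by (auto simp: re_vec_def im_vec_def proj10_def proj01_def endo_C_def vscale_def fun_eq_iff)
  show "proj10 (J p) V \<in> tangent_space_C A p" "proj01 (J p) V \<in> tangent_space_C A p"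
    using assms unfolding tangent_space_C_def mem_Collect_eq r
    by (auto simp: almost_complex_structure_def intro!: tangent_space_closed)
qed

lemma hodge_types:
  assumes J: "almost_complex_structure A J" and \<omega>: "two_form A \<omega>"
    and T: "{Z, Z', W, W', V} \<subseteq> tangent_space_C A p"
    and Z: "endo_C (J p) Z = (\<lambda>f. \<i> * Z f)" and Z': "endo_C (J p) Z' = (\<lambda>f. \<i> * Z' f)"
    and W: "endo_C (J p) W = (\<lambda>f. - \<i> * W f)" and W': "endo_C (J p) W' = (\<lambda>f. - \<i> * W' f)"
  shows "part11 (J p) (\<omega> p) Z Z' = 0" "part11 (J p) (\<omega> p) W W' = 0"
    and "part20 (J p) (\<omega> p) W V = 0" "part20 (J p) (\<omega> p) V W = 0"
    and "part02 (J p) (\<omega> p) Z V = 0" "part02 (J p) (\<omega> p) V Z = 0"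
proof -
  have "proj01 (J p) Z = (\<lambda>f. 0)" "proj01 (J p) Z' = (\<lambda>f. 0)"
    "proj10 (J p) W = (\<lambda>f. 0)" "proj10 (J p) W' = (\<lambda>f. 0)"
    using Z Z' W W' by (auto simp: proj01_def proj10_def)
  then show "part11 (J p) (\<omega> p) Z Z' = 0" "part11 (J p) (\<omega> p) W W' = 0"
    "part20 (J p) (\<omega> p) W V = 0" "part20 (J p) (\<omega> p) V W = 0"
    "part02 (J p) (\<omega> p) Z V = 0" "part02 (J p) (\<omega> p) V Z = 0"
    using T by (auto simp: part11_def part20_def part02_def bilin_C_zero[OF \<omega>] proj_closed[OF J])
qed

lemma part11_real:
  assumes J: "almost_complex_structure A J" and \<omega>: "two_form A \<omega>"
    and v: "v \<in> tangent_space A p" and w: "w \<in> tangent_space A p"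
  shows "part11 (J p) (\<omega> p) (cvec v) (cvec w) = complex_of_real (hodge11 J \<omega> p v w)"
proof -
  have "(\<lambda>f. 0) = vscale 0 v" by (auto simp: vscale_def)
  then have "J p (\<lambda>f. 0) = vscale 0 (J p v)"
    using J v by (auto simp: almost_complex_structure_def)
  then have J0: "J p (\<lambda>f. 0) f = 0" for f by (simp add: vscale_def)
  have r: "re_vec (proj10 (J p) (cvec u)) = vscale (1/2) u"
    "im_vec (proj10 (J p) (cvec u)) = vscale (-1/2) (J p u)"
    "re_vec (proj01 (J p) (cvec u)) = vscale (1/2) u"
    "im_vec (proj01 (J p) (cvec u)) = vscale (1/2) (J p u)" for u
    by (auto simp: re_vec_def im_vec_def proj10_def proj01_def endo_C_def vscale_def cvec_def J0)
  have B: "\<omega> p (vscale c x) y = c * \<omega> p x y" "\<omega> p x (vscale c y) = c * \<omega> p x y"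
    if "x \<in> tangent_space A p" "y \<in> tangent_space A p" for x y c
    using \<omega> that by (auto simp: two_form_def bilinear_field_def)
  have JT: "J p v \<in> tangent_space A p" "J p w \<in> tangent_space A p"
    using J v w by (auto simp: almost_complex_structure_def)
  show ?thesis
    unfolding hodge11_def part11_def bilin_C_def r complex_eq_iff
    by (simp add: B v w JT tangent_space_closed)
qed

end

theory Submission
  imports Defs
begin

text \<open>
  On real vectors \<open>\<omega>\<^sup>1\<^sup>1 = (\<omega> + \<eta>) / 2\<close> with \<open>\<eta> = \<omega>(J\<cdot>, J\<cdot>)\<close>, so the point is that \<open>\<eta>\<close> is closed.
  As \<open>\<nabla>\<close> is torsionfree, \<open>d\<eta>(X, Y, Z)\<close> is the cyclic sum of
  \<open>(\<nabla>\<^sub>X \<eta>)(Y, Z) = \<omega>(S(X, Y), JZ) - \<omega>(S(X, Z), JY)\<close>, where \<open>S(X, Y) = (\<nabla>\<^sub>X J)Y\<close>, and this sum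
  cancels because \<open>S\<close> is symmetric.
\<close>

section \<open>Smooth functions under sums and scalar multiples\<close>

text \<open>On an open set, a derivative depends only on the values nearby. The closure lemmas below
  need this because their derivative formulas hold only on \<open>S\<close>; elsewhere
  \<open>frechet_derivative\<close> may take unrelated values.\<close>

lemma Ck_on_cong:
  assumes "open S" "\<And>x. x \<in> S \<Longrightarrow> f x = g x" "Ck_on k S f"
  shows "Ck_on k S g"
  using assms(2,3)
proof (induction k arbitrary: f g)
  case 0
  then show ?case using continuous_on_cong[of S S f g] by simp
next
  case (Suc k)
  have D: "(g has_derivative frechet_derivative f (at x)) (at x)" if "x \<in> S" for x
  proof (rule has_derivative_transform_within_open[OF _ \<open>open S\<close> that])
    show "(f has_derivative frechet_derivative f (at x)) (at x)"
      using Suc.prems(2) that by (simp add: frechet_derivative_works[symmetric])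
  qed (use Suc.prems(1) in auto)
  have eq: "frechet_derivative f (at x) v = frechet_derivative g (at x) v" if "x \<in> S" for x v
    by (simp only: frechet_derivative_at[OF D[OF that]])
  have "Ck_on k S (\<lambda>x. frechet_derivative f (at x) v)" for v
    using Suc.prems(2) by simp
  then have "Ck_on k S (\<lambda>x. frechet_derivative g (at x) v)" for v
    by (rule Suc.IH[rotated]) (rule eq)
  then show ?case using differentiableI[OF D] unfolding Ck_on.simps by (intro conjI ballI allI)
qed

lemma Ck_on_add:
  assumes "open S" "Ck_on k S f" "Ck_on k S g"
  shows "Ck_on k S (\<lambda>x. f x + g x)"
  using assms(2,3)
proof (induction k arbitrary: f g)
  case 0
  then show ?case by (simp add: continuous_on_add)
next
  case (Suc k)
  have D: "((\<lambda>x. f x + g x) has_derivative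
      (\<lambda>v. frechet_derivative f (at x) v + frechet_derivative g (at x) v)) (at x)"
    if "x \<in> S" for x
    using Suc.prems that
    by (intro has_derivative_add) (simp_all add: frechet_derivative_works[symmetric])
  have eq: "frechet_derivative f (at x) v + frechet_derivative g (at x) v
      = frechet_derivative (\<lambda>x. f x + g x) (at x) v" if "x \<in> S" for x v
    by (simp only: frechet_derivative_at[OF D[OF that], symmetric])
  \<comment> \<open>The induction hypothesis controls the sum of the derivatives, the recursion of
    \<open>Ck_on\<close> asks for the derivative of the sum; \<open>eq\<close> and
    \<open>Ck_on_cong\<close> bridge the two.\<close>
  have "Ck_on k S (\<lambda>x. frechet_derivative f (at x) v + frechet_derivative g (at x) v)" for v
    using Suc.prems by (intro Suc.IH) simp_all
  then have "Ck_on k S (\<lambda>x. frechet_derivative (\<lambda>x. f x + g x) (at x) v)" for v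
    by (rule Ck_on_cong[OF \<open>open S\<close>, rotated]) (rule eq)
  then show ?case using differentiableI[OF D] unfolding Ck_on.simps by (intro conjI ballI allI)
qed

lemma Ck_on_cmult:
  assumes "open S" "Ck_on k S f"
  shows "Ck_on k S (\<lambda>x. c * f x)"
  using assms(2)
proof (induction k arbitrary: f)
  case 0
  then show ?case by (simp add: continuous_on_mult_left)
next
  case (Suc k)
  have D: "((\<lambda>x. c * f x) has_derivative (\<lambda>v. c * frechet_derivative f (at x) v)) (at x)"
    if "x \<in> S" for x
    using Suc.prems that
    by (intro has_derivative_mult_right) (simp add: frechet_derivative_works[symmetric])
  have eq: "c * frechet_derivative f (at x) v = frechet_derivative (\<lambda>x. c * f x) (at x) v"
    if "x \<in> S" for x v
    by (simp only: frechet_derivative_at[OF D[OF that], symmetric])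
  have "Ck_on k S (\<lambda>x. c * frechet_derivative f (at x) v)" for v
    using Suc.prems by (intro Suc.IH) simp
  then have "Ck_on k S (\<lambda>x. frechet_derivative (\<lambda>x. c * f x) (at x) v)" for v
    by (rule Ck_on_cong[OF \<open>open S\<close>, rotated]) (rule eq)
  then show ?case using differentiableI[OF D] unfolding Ck_on.simps by (intro conjI ballI allI)
qed

lemma smooth_fun_add:
  assumes "holomorphic_atlas A" "smooth_fun A f" "smooth_fun A g"
  shows "smooth_fun A (\<lambda>x. f x + g x)"
  unfolding smooth_fun_def
proof clarify
  fix U \<phi> assume c: "(U, \<phi>) \<in> A"
  have o: "open (\<phi> ` U)" using assms(1) c by (auto simp: holomorphic_atlas_def)
  have f: "Ck_on k (\<phi> ` U) (\<lambda>x. f (inv_into U \<phi> x))" for k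
    using assms(2) c by (auto simp: smooth_fun_def smooth_on_def comp_def)
  have g: "Ck_on k (\<phi> ` U) (\<lambda>x. g (inv_into U \<phi> x))" for k
    using assms(3) c by (auto simp: smooth_fun_def smooth_on_def comp_def)
  show "smooth_on (\<phi> ` U) ((\<lambda>x. f x + g x) \<circ> inv_into U \<phi>)"
    unfolding smooth_on_def comp_def by (intro allI Ck_on_add o f g)
qed

lemma smooth_fun_cmult:
  assumes "holomorphic_atlas A" "smooth_fun A f"
  shows "smooth_fun A (\<lambda>x. c * f x)"
  unfolding smooth_fun_def
proof clarify
  fix U \<phi> assume c: "(U, \<phi>) \<in> A"
  have o: "open (\<phi> ` U)" using assms(1) c by (auto simp: holomorphic_atlas_def)
  have f: "Ck_on k (\<phi> ` U) (\<lambda>x. f (inv_into U \<phi> x))" for k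
    using assms(2) c by (auto simp: smooth_fun_def smooth_on_def comp_def)
  show "smooth_on (\<phi> ` U) ((\<lambda>x. c * f x) \<circ> inv_into U \<phi>)"
    unfolding smooth_on_def comp_def by (intro allI Ck_on_cmult o f)
qed

section \<open>Pointwise linear algebra of tangent vectors and forms\<close>

text \<open>Closure of tangent spaces and linearity of \<open>J\<close> and of forms are available
  for \<open>+\<close> and \<open>vscale\<close>; this identity and the next two reduce differences,
  negatives and zero to these operations.\<close>

lemma diff_eq_add_vscale: "v - w = v + vscale (-1) w"
  by (auto simp: vscale_def fun_eq_iff)

lemma uminus_eq_vscale: "- v = vscale (-1) v"
  by (auto simp: vscale_def fun_eq_iff)

lemma zero_eq_vscale: "0 = vscale 0 v"
  by (auto simp: vscale_def fun_eq_iff)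

lemma two_form_bilinear: "two_form A \<omega> \<Longrightarrow> bilinear_field A \<omega>"
  by (simp add: two_form_def)

lemma bilinear_field_simps:
  assumes "bilinear_field A B" "u \<in> tangent_space A p" "v \<in> tangent_space A p"
  shows "w \<in> tangent_space A p \<Longrightarrow> B p (u + v) w = B p u w + B p v w"
    and "w \<in> tangent_space A p \<Longrightarrow> B p w (u + v) = B p w u + B p w v"
    and "w \<in> tangent_space A p \<Longrightarrow> B p (u - v) w = B p u w - B p v w"
    and "w \<in> tangent_space A p \<Longrightarrow> B p w (u - v) = B p w u - B p w v"
    and "B p (vscale c u) v = c * B p u v" and "B p u (vscale c v) = c * B p u v"
    and "B p (- u) v = - B p u v" and "B p u (- v) = - B p u v"
  using assms unfolding bilinear_field_def diff_eq_add_vscale uminus_eq_vscale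
  by (simp_all add: tangent_space_closed)

lemma two_form_skew:
  assumes "two_form A \<omega>" "v \<in> tangent_space A p" "w \<in> tangent_space A p"
  shows "\<omega> p v w = - \<omega> p w v"
proof -
  have "\<omega> p (v + w) (v + w) = 0"
    using assms by (simp add: two_form_def tangent_space_add)
  moreover have "\<omega> p v v = 0" "\<omega> p w w = 0" using assms by (simp_all add: two_form_def)
  ultimately show ?thesis
    using assms(2,3)
    by (simp add: bilinear_field_simps[OF two_form_bilinear[OF assms(1)]] tangent_space_add)
qed

section \<open>The (1,1)-component on real vectors\<close>

text \<open>A real v splits as (v - iJv)/2 + (v + iJv)/2 into types (1,0) and (0,1). Each of the two
  mixed products has real part (\<omega>(v, w) + \<omega>(Jv, Jw))/4.\<close>

lemma hodge11_eq:
  assumes J: "almost_complex_structure A J" and \<omega>: "two_form A \<omega>"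
    and v: "v \<in> tangent_space A p" and w: "w \<in> tangent_space A p"
  shows "hodge11 J \<omega> p v w = (\<omega> p v w + \<omega> p (J p v) (J p w)) / 2"
proof -
  \<comment> \<open>\<open>endo_C\<close> also applies \<open>J\<close> to the imaginary part of
    \<open>cvec u\<close>, which is zero, so \<open>J p 0\<close> must be known to vanish.\<close>
  have "J p 0 = vscale 0 (J p v)"
    using J v zero_eq_vscale[of v] by (metis almost_complex_structure_def)
  then have J0: "J p (\<lambda>f. 0) f = 0" for f by (simp add: vscale_def zero_fun_def)
  have r: "re_vec (proj10 (J p) (cvec u)) = vscale (1/2) u"
    "im_vec (proj10 (J p) (cvec u)) = vscale (-1/2) (J p u)"
    "re_vec (proj01 (J p) (cvec u)) = vscale (1/2) u"
    "im_vec (proj01 (J p) (cvec u)) = vscale (1/2) (J p u)" for u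
    by (auto simp: re_vec_def im_vec_def proj10_def proj01_def endo_C_def vscale_def cvec_def J0)
  have JT: "J p v \<in> tangent_space A p" "J p w \<in> tangent_space A p"
    using J v w by (auto simp: almost_complex_structure_def)
  show ?thesis
    unfolding hodge11_def part11_def bilin_C_def r
    using \<omega> v w JT
    by (simp add: bilinear_field_simps(5,6)[OF two_form_bilinear[OF \<omega>]] tangent_space_closed)
qed

lemma vector_field_tangent: "vector_field A X \<Longrightarrow> X p \<in> tangent_space A p"
  by (simp add: vector_field_def)

lemma tangent_half_add:
  assumes "holomorphic_atlas A" "v \<in> tangent_space A p" "smooth_fun A f" "smooth_fun A g"
  shows "v (\<lambda>q. (f q + g q) / 2) = (v f + v g) / 2"
proof -
  \<comment> \<open>Tangent vectors are linear on smooth functions only, so the factor 1/2 can be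
    pulled out once the sum is known to be smooth.\<close>
  have "smooth_fun A (f + g)"
    using smooth_fun_add[OF assms(1,3,4)] by (simp add: plus_fun_def)
  then have "v (\<lambda>q. 1/2 * (f + g) q) = 1/2 * v (f + g)"
    using assms(2) unfolding tangent_space_def by blast
  moreover have "v (f + g) = v f + v g"
    using assms(2-4) unfolding tangent_space_def by blast
  ultimately show ?thesis by simp
qed

lemma hodge11_two_form:
  assumes "holomorphic_atlas A" and J: "almost_complex_structure A J" and \<omega>: "two_form A \<omega>"
  shows "two_form A (hodge11 J \<omega>)"
proof -
  note B = bilinear_field_simps[OF two_form_bilinear[OF \<omega>]]
  have JT: "J p v \<in> tangent_space A p" if "v \<in> tangent_space A p" for p v
    using J that by (auto simp: almost_complex_structure_def)
  have J_lin: "J p (u + v) = J p u + J p v" "J p (vscale c u) = vscale c (J p u)"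
    if "u \<in> tangent_space A p" "v \<in> tangent_space A p" for p u v c
    using J that by (auto simp: almost_complex_structure_def)
  have "smooth_fun A (\<lambda>p. hodge11 J \<omega> p (X p) (Y p))"
    if X: "vector_field A X" and Y: "vector_field A Y" for X Y
  proof -
    \<comment> \<open>Smoothness of \<eta> along X and Y is smoothness of \<omega> along the vector
      fields JX and JY.\<close>
    have "vector_field A (appl J X)" "vector_field A (appl J Y)"
      using J X Y by (auto simp: almost_complex_structure_def)
    then have "smooth_fun A (\<lambda>p. \<omega> p (X p) (Y p))"
      "smooth_fun A (\<lambda>p. \<omega> p (appl J X p) (appl J Y p))"
      using \<omega> X Y by (auto simp: two_form_def bilinear_field_def)
    then have "smooth_fun A
        (\<lambda>p. 1/2 * (\<omega> p (X p) (Y p) + \<omega> p (appl J X p) (appl J Y p)))"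
      by (intro smooth_fun_cmult smooth_fun_add assms(1))
    then show ?thesis
      by (simp add: hodge11_eq[OF J \<omega>] vector_field_tangent X Y appl_def)
  qed
  moreover have "\<omega> p v v = 0" if "v \<in> tangent_space A p" for p v
    using \<omega> that by (simp add: two_form_def)
  ultimately show ?thesis
    unfolding two_form_def bilinear_field_def
    by (auto simp: hodge11_eq[OF J \<omega>] tangent_space_closed J_lin B JT field_simps)
qed

text \<open>Inserting \<open>J\<close> in both slots exchanges \<omega> and \<eta>, since the two
  signs from J(Jv) = -v and J(Jw) = -w cancel.\<close>

lemma hodge11_J_invariant:
  assumes J: "almost_complex_structure A J" and \<omega>: "two_form A \<omega>"
  shows "J_invariant A J (hodge11 J \<omega>)"
  unfolding J_invariant_def
proof (intro allI ballI)
  fix p v w assume v: "v \<in> tangent_space A p" and w: "w \<in> tangent_space A p"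
  have T: "J p v \<in> tangent_space A p" "J p w \<in> tangent_space A p"
    and JJ: "J p (J p v) = - v" "J p (J p w) = - w"
    using J v w by (auto simp: almost_complex_structure_def)
  have "- w \<in> tangent_space A p"
    using w by (simp add: uminus_eq_vscale tangent_space_vscale)
  then show "hodge11 J \<omega> p (J p v) (J p w) = hodge11 J \<omega> p v w"
    by (simp add: hodge11_eq[OF J \<omega>] v w T JJ
        bilinear_field_simps(7,8)[OF two_form_bilinear[OF \<omega>]])
qed

section \<open>Closedness of the (1,1)-component\<close>

lemma torsionfree_bracket:
  assumes "torsionfree A nabla" "vector_field A X" "vector_field A Y"
  shows "lie_bracket X Y = nabla X Y - nabla Y X"
proof -
  have "nabla X Y - nabla Y X - lie_bracket X Y = 0"
    using assms unfolding torsionfree_def by blast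
  then show ?thesis by (simp only: right_minus_eq)
qed

lemma ext_deriv_hodge11:
  assumes "holomorphic_atlas A" and J: "almost_complex_structure A J" and \<omega>: "two_form A \<omega>"
    and nabla: "connection A nabla" "torsionfree A nabla"
    and V: "vector_field A X" "vector_field A Y" "vector_field A Z"
  shows "ext_deriv (hodge11 J \<omega>) X Y Z p
    = (ext_deriv \<omega> X Y Z p + ext_deriv (\<lambda>q v w. \<omega> q (J q v) (J q w)) X Y Z p) / 2"
proof -
  \<comment> \<open>\<open>hodge11_eq\<close> applies to tangent vectors. For a bracket, tangency is
    read off from its expression as a difference of covariant derivatives.\<close>
  have "lie_bracket U W p \<in> tangent_space A p"
    if "vector_field A U" "vector_field A W" for U W
  proof -
    show ?thesis
      using nabla(1) that torsionfree_bracket[OF nabla(2) that]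
      by (simp add: connection_def diff_eq_add_vscale tangent_space_closed vector_field_tangent)
  qed
  moreover have "U p (\<lambda>q. hodge11 J \<omega> q (W q) (W' q))
      = (U p (\<lambda>q. \<omega> q (W q) (W' q)) + U p (\<lambda>q. \<omega> q (J q (W q)) (J q (W' q)))) / 2"
    if "vector_field A U" "vector_field A W" "vector_field A W'" for U W W'
  proof -
    have "vector_field A (appl J W)" "vector_field A (appl J W')"
      using J that by (auto simp: almost_complex_structure_def)
    then have "smooth_fun A (\<lambda>q. \<omega> q (W q) (W' q))"
      "smooth_fun A (\<lambda>q. \<omega> q (appl J W q) (appl J W' q))"
      using \<omega> that by (auto simp: two_form_def bilinear_field_def)
    then show ?thesis
      using tangent_half_add[OF assms(1) vector_field_tangent] that
      by (simp add: hodge11_eq[OF J \<omega>] vector_field_tangent appl_def)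
  qed
  ultimately show ?thesis
    using V unfolding ext_deriv_def
    by (simp add: hodge11_eq[OF J \<omega>] vector_field_tangent field_simps)
qed

lemma closed_form_pullback_J:
  assumes "special_symplectic A J nabla \<omega>"
  shows "closed_form A (\<lambda>p v w. \<omega> p (J p v) (J p w))"
  unfolding closed_form_def
proof (intro allI impI ext)
  fix X Y Z p
  assume V: "vector_field A X" "vector_field A Y" "vector_field A Z"
  have J: "almost_complex_structure A J" and \<omega>: "two_form A \<omega>"
    and nabla: "connection A nabla" "torsionfree A nabla"
    and par: "parallel_form A nabla \<omega>"
    and S_sym: "\<And>X Y. vector_field A X \<Longrightarrow> vector_field A Y \<Longrightarrow>
      cov_deriv_endo nabla J X Y = cov_deriv_endo nabla J Y X"
    using assms
    by (auto simp: special_symplectic_def special_complex_def complex_manifold_def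
        symplectic_form_def)
  define S where "S U W = cov_deriv_endo nabla J U W p" for U W
  have JV: "vector_field A (appl J U)" if "vector_field A U" for U
    using J that by (simp add: almost_complex_structure_def)
  have nV: "vector_field A (nabla U W)" if "vector_field A U" "vector_field A W" for U W
    using nabla(1) that by (simp add: connection_def)
  have JT: "J p v \<in> tangent_space A p" if "v \<in> tangent_space A p" for v
    using J that by (simp add: almost_complex_structure_def)
  have J_diff: "J p (u - v) = J p u - J p v"
    if "u \<in> tangent_space A p" "v \<in> tangent_space A p" for u v
    using J that unfolding diff_eq_add_vscale
    by (simp add: almost_complex_structure_def tangent_space_closed)
  note T = vector_field_tangent[of A _ p]
  note B = bilinear_field_simps[OF two_form_bilinear[OF \<omega>]]
  have ST: "S U W \<in> tangent_space A p" if "vector_field A U" "vector_field A W" for U W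
    using that T[OF nV[OF that(1) JV[OF that(2)]]] T[OF nV[OF that]]
    by (simp add: S_def cov_deriv_endo_def appl_def diff_eq_add_vscale tangent_space_closed JT)
  have nabla_J: "nabla U (appl J W) p = S U W + J p (nabla U W p)" for U W
    by (simp add: S_def cov_deriv_endo_def appl_def)
  have bracket: "lie_bracket U W p = nabla U W p - nabla W U p"
    if "vector_field A U" "vector_field A W" for U W
    using torsionfree_bracket[OF nabla(2) that] by simp
  \<comment> \<open>This is parallelism of \<omega> evaluated on the fields JW and JW', with
    \<open>nabla_J\<close> splitting each covariant derivative. Skewness moves the derivative terms
    of W' into the first slot, ready for the cancellation at the end.\<close>
  have deriv: "U p (\<lambda>q. \<omega> q (J q (W q)) (J q (W' q)))
      = \<omega> p (S U W) (J p (W' p)) + \<omega> p (J p (nabla U W p)) (J p (W' p))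
        - \<omega> p (S U W') (J p (W p)) - \<omega> p (J p (nabla U W' p)) (J p (W p))"
    if U: "vector_field A U" "vector_field A W" "vector_field A W'" for U W W'
  proof -
    have "cov_deriv_form nabla \<omega> U (appl J W) (appl J W') p = 0"
      using par U JV by (simp add: parallel_form_def)
    then have "U p (\<lambda>q. \<omega> q (J q (W q)) (J q (W' q)))
        = \<omega> p (S U W + J p (nabla U W p)) (J p (W' p))
          + \<omega> p (J p (W p)) (S U W' + J p (nabla U W' p))"
      unfolding cov_deriv_form_def nabla_J by (simp add: appl_def)
    then show ?thesis
      using U two_form_skew[OF \<omega>, of "J p (W p)" p "S U W'"]
        two_form_skew[OF \<omega>, of "J p (W p)" p "J p (nabla U W' p)"]
      by (simp add: B ST JT T nV)
  qed
  \<comment> \<open>In the cyclic sum, the \<eta>-terms in the covariant derivatives cancel against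
    the brackets. Six terms in \<open>S\<close> remain; they form pairs such as \<omega>(S(X, Y),
    JZ) - \<omega>(S(Y, X), JZ), which these equations make vanish.\<close>
  have "S Y X = S X Y" "S Z X = S X Z" "S Z Y = S Y Z"
    using S_sym V by (simp_all add: S_def)
  then show "ext_deriv (\<lambda>p v w. \<omega> p (J p v) (J p w)) X Y Z p = 0 p"
    unfolding ext_deriv_def
    by (simp add: deriv bracket V J_diff B JT T nV)
qed

lemma hodge11_closed:
  assumes "special_symplectic A J nabla \<omega>"
  shows "closed_form A (hodge11 J \<omega>)"
  using assms closed_form_pullback_J[OF assms]
  by (auto simp: closed_form_def ext_deriv_hodge11 fun_eq_iff special_symplectic_def
      special_complex_def complex_manifold_def symplectic_form_def)

section \<open>The metric of a nondegenerate J-invariant 2-form\<close>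

lemma metric_of_pseudo_riemannian:
  assumes J: "almost_complex_structure A J" and \<omega>: "two_form A \<omega>"
    and nd: "nondegenerate A \<omega>" and inv: "J_invariant A J \<omega>"
  shows "pseudo_riemannian_metric A (metric_of J \<omega>)"
proof -
  note B = bilinear_field_simps[OF two_form_bilinear[OF \<omega>]]
  have JT: "J p v \<in> tangent_space A p" and JJ: "J p (J p v) = - v"
    and J_vscale: "J p (vscale c v) = vscale c (J p v)"
    if "v \<in> tangent_space A p" for p v c
    using J that by (auto simp: almost_complex_structure_def)
  have J_add: "J p (u + v) = J p u + J p v"
    if "u \<in> tangent_space A p" "v \<in> tangent_space A p" for p u v
    using J that by (auto simp: almost_complex_structure_def)
  have "smooth_fun A (\<lambda>p. \<omega> p (J p (X p)) (Y p))"
    if "vector_field A X" "vector_field A Y" for X Y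
  proof -
    have "vector_field A (appl J X)"
      using J that by (simp add: almost_complex_structure_def)
    then have "smooth_fun A (\<lambda>p. \<omega> p (appl J X p) (Y p))"
      using \<omega> that by (simp add: two_form_def bilinear_field_def)
    then show ?thesis by (simp add: appl_def)
  qed
  then have "bilinear_field A (metric_of J \<omega>)"
    unfolding bilinear_field_def metric_of_def
    by (auto simp: J_add J_vscale B JT)
  moreover have "metric_of J \<omega> p v w = metric_of J \<omega> p w v"
    if v: "v \<in> tangent_space A p" and w: "w \<in> tangent_space A p" for p v w
  proof -
    \<comment> \<open>Invariance and J(Jv) = -v carry \<open>J\<close> over to w at the cost of a
      sign, which skewness removes.\<close>
    have "\<omega> p (J p v) w = \<omega> p (J p (J p v)) (J p w)"
      using inv JT[OF v] w by (simp add: J_invariant_def)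
    also have "\<dots> = \<omega> p (J p w) v"
      using v w two_form_skew[OF \<omega> v JT[OF w]] by (simp add: JJ B JT)
    finally show ?thesis by (simp add: metric_of_def)
  qed
  moreover have "v = 0"
    if v: "v \<in> tangent_space A p" and "\<forall>w\<in>tangent_space A p. metric_of J \<omega> p v w = 0" for p v
  proof -
    \<comment> \<open>A vector in the kernel of the metric has Jv in the kernel of \<omega>; then -v
      = J(Jv) = J0 = 0.\<close>
    have "J p v = 0"
      using nd that JT[OF v] by (simp add: nondegenerate_def metric_of_def)
    then have "- v = J p (vscale 0 v)" using JJ[OF v] zero_eq_vscale[of v] by simp
    also have "\<dots> = vscale 0 (J p v)" by (rule J_vscale[OF v])
    also have "\<dots> = 0" by (rule zero_eq_vscale[symmetric])
    finally show "v = 0" by simp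
  qed
  ultimately show ?thesis
    by (auto simp: pseudo_riemannian_metric_def nondegenerate_def)
qed

lemma metric_of_J_invariant:
  assumes "almost_complex_structure A J" "J_invariant A J \<omega>"
  shows "J_invariant A J (metric_of J \<omega>)"
  unfolding J_invariant_def metric_of_def
proof (intro allI ballI)
  fix p v w assume "v \<in> tangent_space A p" "w \<in> tangent_space A p"
  moreover from this have "J p v \<in> tangent_space A p"
    using assms(1) by (simp add: almost_complex_structure_def)
  ultimately show "\<omega> p (J p (J p v)) (J p w) = \<omega> p (J p v) w"
    using assms(2) unfolding J_invariant_def by blast
qed

theorem proposition5:
  fixes A :: "('a::{t2_space, second_countable_topology}, 'n::finite) chart set"
    and J :: "'a \<Rightarrow> 'a tvec \<Rightarrow> 'a tvec"
    and nabla :: "'a vfield \<Rightarrow> 'a vfield \<Rightarrow> 'a vfield"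
    and \<omega> :: "'a \<Rightarrow> 'a bilin"
  assumes "special_symplectic A J nabla \<omega>"
    and "nondegenerate A (hodge11 J \<omega>)"
  shows "kaehler_manifold A J (hodge11 J \<omega>) (metric_of J (hodge11 J \<omega>)) \<and>
         (special_kaehler A J nabla (hodge11 J \<omega>) \<longleftrightarrow> parallel_form A nabla (hodge11 J \<omega>))"
proof -
  have M: "special_complex A J nabla" "complex_manifold A J" "holomorphic_atlas A"
    and J: "almost_complex_structure A J" and \<omega>: "two_form A \<omega>"
    using assms(1)
    by (auto simp: special_symplectic_def special_complex_def complex_manifold_def
        symplectic_form_def)
  have two: "two_form A (hodge11 J \<omega>)" and inv: "J_invariant A J (hodge11 J \<omega>)"
    using hodge11_two_form hodge11_J_invariant M J \<omega> by auto
  have "symplectic_form A (hodge11 J \<omega>)"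
    using two assms(2) hodge11_closed[OF assms(1)] by (simp add: symplectic_form_def)
  \<comment> \<open>The conditions on \<open>J\<close> and \<open>nabla\<close> do not mention the
    form and are inherited. The (1,1)-component is already symplectic and J-invariant, so being
    special Kaehler comes down to being parallel.\<close>
  then show ?thesis
    using M(1,2) inv metric_of_pseudo_riemannian[OF J two assms(2) inv]
      metric_of_J_invariant[OF J inv]
    by (auto simp: kaehler_manifold_def special_kaehler_def special_symplectic_def)
qed

end
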